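(* Let $X_1,\dots,X_n$ be independent random variables with $\mathsf E X_k=0$, $\sigma_k^2=\mathsf E X_k^2$, $\beta_k=\mathsf E|X_k|^3<\infty$, $k=1,\dots,n$; $S_n=\sum_{k=1}^nX_k$, $B_n^2=\sum_{k=1}^n\sigma_k^2>0$, $L^3=B_n^{-3}\sum_{k=1}^n\beta_k$. Then $$\Delta_n:=\sup_{x\in\mathbb R}|\mathsf P(S_n<xB_n)-\Phi(x)|\le C_0L^3,$$ where $C_0$ is an absolute constant; one can take $$C_0=\frac2{\sqrt{2\pi}}\inf\Big\{\frac{b}{(1-2d/3)^{3/2}}+\frac{2b(b+1)}{\pi d(b-1)}\colon b>1,\ d\in\big(0,\tfrac32\big)\Big\}.$$
   Context: $\Phi$ is the standard normal distribution function. The symbol $L^3$ denotes the Lyapunov fraction of order three as defined in the claim. *)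

theory Defs
  imports "HOL-Probability.Probability"
begin

text \<open>
  Random variables are indexed by \<open>{1..n}\<close>; \<open>X k\<close> is irrelevant for other \<open>k\<close>.
\<close>

definition std_normal_cdf :: "real \<Rightarrow> real"
  where "std_normal_cdf = cdf std_normal_distribution"

definition partial_sum :: "(nat \<Rightarrow> 'a \<Rightarrow> real) \<Rightarrow> nat \<Rightarrow> 'a \<Rightarrow> real"
  where "partial_sum X n \<omega> = (\<Sum>k=1..n. X k \<omega>)"

definition sum_variance :: "'a measure \<Rightarrow> (nat \<Rightarrow> 'a \<Rightarrow> real) \<Rightarrow> nat \<Rightarrow> real"
  where "sum_variance M X n = (\<Sum>k=1..n. (\<integral>\<omega>. (X k \<omega>)\<^sup>2 \<partial>M))"

definition norming :: "'a measure \<Rightarrow> (nat \<Rightarrow> 'a \<Rightarrow> real) \<Rightarrow> nat \<Rightarrow> real"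
  where "norming M X n = sqrt (sum_variance M X n)"

text \<open>The Lyapunov fraction itself, written \<open>L\<^sup>3\<close> in the literature (not its cube root).\<close>

definition lyapunov_fraction3 :: "'a measure \<Rightarrow> (nat \<Rightarrow> 'a \<Rightarrow> real) \<Rightarrow> nat \<Rightarrow> real"
  where "lyapunov_fraction3 M X n =
    (\<Sum>k=1..n. (\<integral>\<omega>. \<bar>X k \<omega>\<bar> ^ 3 \<partial>M)) / norming M X n ^ 3"

text \<open>
  The distribution function is the left-continuous one, \<open>P (S < x)\<close>, unlike \<^const>\<open>cdf\<close>.
  The supremum is taken over a subset of \<open>[0, 1]\<close>.
\<close>

definition normal_distance :: "'a measure \<Rightarrow> (nat \<Rightarrow> 'a \<Rightarrow> real) \<Rightarrow> nat \<Rightarrow> real"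
  where "normal_distance M X n =
    (SUP x::real. \<bar>measure M {\<omega> \<in> space M. partial_sum X n \<omega> < x * norming M X n}
                    - std_normal_cdf x\<bar>)"

text \<open>The infimum is taken over a nonempty set of positive reals.\<close>

definition berry_esseen_const :: real
  where "berry_esseen_const = 2 / sqrt (2 * pi) *
    Inf {b / (1 - 2 * d / 3) powr (3 / 2) + 2 * b * (b + 1) / (pi * d * (b - 1)) | b d :: real.
         1 < b \<and> 0 < d \<and> d < 3 / 2}"

end

(* With F the law of S_n / B_n and f its characteristic function, convolve D = F - Phi with the
   Fejer kernel of bandwidth T = d / L^3.  Since D decreases at rate at most 1 / sqrt (2 pi), a
   large value of |D| persists on an interval beside the point where it is attained; choosing the
   length of that interval so that it carries mass (1 + 1/b) / 2 of the kernel gives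
     sup |D| <= b sup |D * kernel| + (const / T),
   and Fourier inversion bounds D * kernel by the integral of |f(t) - exp(-t^2/2)| / |t| over
   [-T, T].  There |f(t) - exp(-t^2/2)| <= 2 L^3 |t|^3 exp(-t^2/2 + L^3 |t|^3 / 3): this is the
   triangle inequality when L^3 |t|^3 >= 1, and a telescoping product otherwise.  Both cases rest
   on |f_k(t)| <= exp(-sigma_k^2 t^2 / 2 + beta_k |t|^3 / 3), which comes from symmetrization. *)
theory Submission
  imports Defs "HOL-Real_Asymp.Real_Asymp"
begin

subsection \<open>The Fejer kernel\<close>

text \<open>The Fejer kernel is nonnegative, which lets masses be compared, and its Fourier
  transform has compact support, which confines the comparison of characteristic functions to a
  bounded band. The price is a tail of order 1/r, the source of the factor 1/(b - 1). In the band
  |t| <= d / L^3 the term L^3 |t|^3 / 3 is at most d t^2 / 3, so the Gaussian keeps the rate 1 -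
  2d/3: this is the origin of d < 3/2, and the power 3/2 comes from a Gaussian second moment. The
  parameter b sets the kernel mass of the window, which must exceed 1/2 for the inequality to be
  solvable for sup |D|. The 1/3 in the exponent rests on bounding the symmetrized third moment by 4
  beta_k; the crude 8 beta_k would halve the range of d.\<close>

lemma DERIV_sin_times_sinc_0: "((\<lambda>u. sin u * sinc u) has_real_derivative 1) (at 0)"
proof -
  have "((\<lambda>u::real. sin u / u * sinc u) \<longlongrightarrow> 1 * sinc 0) (at 0)"
    using isCont_sinc[of 0] by (intro tendsto_mult sinc_at_0) (simp add: isCont_def)
  then show ?thesis
    unfolding DERIV_def add_0 by simp
qed

text \<open>Integration by parts: integrating sin^2 u / u^2 leaves the boundary term - sin^2 u / u
  and the integral of sin (2 u) / u, which is Si (2 u). The point 0 is separate because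
  \<open>sinc\<close> takes its limit value there.\<close>

lemma DERIV_sinc_squared_primitive:
  "((\<lambda>u. Si (2 * u) - sin u * sinc u) has_real_derivative (sinc u)\<^sup>2) (at u)"
proof -
  have Si: "((\<lambda>u. Si (2 * u)) has_real_derivative sinc (2 * u) * 2) (at u)"
    by (rule DERIV_chain2[OF DERIV_Si]) (auto intro!: derivative_eq_intros)
  show ?thesis
  proof (cases "u = 0")
    case True
    then show ?thesis
      using DERIV_diff[OF Si] DERIV_sin_times_sinc_0 by fastforce
  next
    case False
    have "((\<lambda>u. sin u * (sin u / u)) has_real_derivative
        2 * sin u * cos u / u - (sin u)\<^sup>2 / u\<^sup>2) (at u)"
      using False by (auto intro!: derivative_eq_intros simp: field_simps power2_eq_square)
    moreover have "eventually (\<lambda>u::real. sin u * (sin u / u) = sin u * sinc u) (nhds u)"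
      using False t1_space_nhds[of u 0] by (auto elim!: eventually_mono)
    ultimately have "((\<lambda>u. sin u * sinc u) has_real_derivative
        2 * sin u * cos u / u - (sin u)\<^sup>2 / u\<^sup>2) (at u)"
      by (rule DERIV_cong_ev[OF refl _ refl, THEN iffD1, rotated])
    from DERIV_diff[OF Si this] show ?thesis
      using False by (simp add: sin_double power_divide)
  qed
qed

lemma sinc_squared_primitive_at_top: "((\<lambda>u. Si (2 * u) - sin u * sinc u) \<longlongrightarrow> pi / 2) at_top"
proof -
  have "((\<lambda>u. Si (2 * u)) \<longlongrightarrow> pi / 2) at_top"
    by (rule filterlim_compose[OF Si_at_top]) real_asymp
  moreover have "((\<lambda>u. sin u * sinc u) \<longlongrightarrow> 0) at_top"
  proof (rule Lim_null_comparison)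
    show "\<forall>\<^sub>F u in at_top. norm (sin u * sinc u) \<le> 1 / u"
      using eventually_gt_at_top[of 0]
    proof eventually_elim
      case (elim u)
      have "\<bar>sin u\<bar> * \<bar>sin u\<bar> \<le> 1 * 1"
        by (intro mult_mono) auto
      then show ?case
        using elim by (simp add: abs_mult field_simps)
    qed
    show "((\<lambda>u::real. 1 / u) \<longlongrightarrow> 0) at_top"
      by real_asymp
  qed
  ultimately show ?thesis
    using tendsto_diff by fastforce
qed

lemma has_bochner_integral_sinc_squared: "has_bochner_integral lborel (\<lambda>u. (sinc u)\<^sup>2) pi"
proof -
  have "(\<integral>\<^sup>+u. ennreal ((sinc u)\<^sup>2) * indicator {0..} u \<partial>lborel) = pi / 2 - 0"
    using nn_integral_FTC_atLeast[OF _ DERIV_sinc_squared_primitive _ sinc_squared_primitive_at_top, of 0]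
    by (simp add: Si_def zero_ereal_def[symmetric])
  then have "has_bochner_integral lborel (\<lambda>u. indicator {0..} u *\<^sub>R (sinc u)\<^sup>2) (pi / 2)"
    by (intro has_bochner_integral_nn_integral)
       (auto simp: ennreal_mult' ennreal_indicator mult.commute)
  then have "has_bochner_integral lborel (\<lambda>u. (sinc u)\<^sup>2) (2 *\<^sub>R (pi / 2))"
    by (rule has_bochner_integral_even_function) simp
  then show ?thesis
    by simp
qed

text \<open>Bandwidth \<open>2 * a\<close>: the Fourier transform is the triangle on \<open>[- 2 * a, 2 * a]\<close>.\<close>

definition fejer :: "real \<Rightarrow> real \<Rightarrow> real"
  where "fejer a y = a / pi * (sinc (a * y))\<^sup>2"

lemma fejer_nonneg: "a > 0 \<Longrightarrow> 0 \<le> fejer a y"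
  by (simp add: fejer_def)

lemma fejer_minus: "fejer a (- y) = fejer a y"
  by (simp add: fejer_def)

lemma borel_measurable_fejer [measurable]: "fejer a \<in> borel_measurable borel"
  unfolding fejer_def by measurable

lemma has_bochner_integral_fejer:
  assumes "a > 0"
  shows "has_bochner_integral lborel (fejer a) 1"
proof -
  have "has_bochner_integral lborel (\<lambda>y. (sinc (0 + a * y))\<^sup>2) (pi /\<^sub>R \<bar>a\<bar>)"
    using assms has_bochner_integral_sinc_squared
    by (subst lborel_has_bochner_integral_real_affine_iff[of "inverse a" _ _ 0])
       (simp_all add: field_simps cong: if_cong)
  from has_bochner_integral_mult_right[OF this, of "a / pi"] show ?thesis
    using assms by (simp add: fejer_def[abs_def] cong: if_cong)
qed

text \<open>Since sin^2 <= 1, the kernel lies below 1 / (pi a y^2), and each of the two tails beyond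
  r has mass at most 1 / (pi a r).\<close>

lemma fejer_tail_integral:
  assumes "a > 0" "r > 0"
  shows "(\<integral>y. fejer a y * indicator {- r..r} y \<partial>lborel) \<ge> 1 - 2 / (pi * a * r)"
proof -
  let ?g = "\<lambda>y. 1 / (pi * a * y\<^sup>2)"
  have g: "has_bochner_integral lborel (\<lambda>y. indicator {r..} y *\<^sub>R ?g y) (1 / (pi * a * r))"
  proof -
    have "(\<integral>\<^sup>+y. ennreal (?g y) * indicator {r..} y \<partial>lborel) = ennreal (0 - (- (1 / (pi * a * r))))"
    proof (rule nn_integral_FTC_atLeast)
      show "((\<lambda>y. - (1 / (pi * a * y))) has_real_derivative ?g y) (at y)" if "r \<le> y" for y
        using that assms by (auto intro!: derivative_eq_intros simp: field_simps power2_eq_square)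
      show "((\<lambda>y. - (1 / (pi * a * y))) \<longlongrightarrow> 0) at_top"
        using assms by real_asymp
    qed (use assms in auto)
    also have "(\<integral>\<^sup>+y. ennreal (?g y) * indicator {r..} y \<partial>lborel) =
        (\<integral>\<^sup>+y. ennreal (indicator {r..} y *\<^sub>R ?g y) \<partial>lborel)"
      by (intro nn_integral_cong) (auto split: split_indicator)
    finally show ?thesis
      using assms by (intro has_bochner_integral_nn_integral) auto
  qed
  have "has_bochner_integral lborel (\<lambda>y. indicator {0..} y *\<^sub>R (?g y * indicator {r..} \<bar>y\<bar>)) (1 / (pi * a * r))"
    using g assms by (rule_tac has_bochner_integral_cong[THEN iffD1, OF _ _ _ g])
      (auto split: split_indicator)
  then have G: "has_bochner_integral lborel (\<lambda>y. ?g y * indicator {r..} \<bar>y\<bar>) (2 *\<^sub>R (1 / (pi * a * r)))"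
    by (rule has_bochner_integral_even_function) simp
  have int: "integrable lborel (\<lambda>y. fejer a y * indicator {- r..r} y)"
    using has_bochner_integral_fejer[OF assms(1)]
    by (intro integrable_real_mult_indicator) (auto simp: has_bochner_integral_iff)
  have "1 = (\<integral>y. fejer a y \<partial>lborel)"
    using has_bochner_integral_fejer[OF assms(1)] by (simp add: has_bochner_integral_iff)
  also have "\<dots> \<le> (\<integral>y. fejer a y * indicator {- r..r} y + ?g y * indicator {r..} \<bar>y\<bar> \<partial>lborel)"
  proof (rule integral_mono)
    fix y
    have "(sin (a * y))\<^sup>2 \<le> 1"
      by (simp add: abs_square_le_1)
    then have "(sin (a * y))\<^sup>2 / (pi * a * y\<^sup>2) \<le> ?g y"
      using assms by (intro divide_right_mono) auto
    moreover have "fejer a y = (sin (a * y))\<^sup>2 / (pi * a * y\<^sup>2)" if "y \<noteq> 0"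
      using that by (simp add: fejer_def power_divide power_mult_distrib) (simp add: power2_eq_square)
    ultimately have "fejer a y \<le> ?g y" if "y \<noteq> 0"
      using that by simp
    then show "fejer a y \<le> fejer a y * indicator {- r..r} y + ?g y * indicator {r..} \<bar>y\<bar>"
      using assms by (auto split: split_indicator)
  qed (use has_bochner_integral_fejer[OF assms(1)] int G in \<open>auto simp: has_bochner_integral_iff\<close>)
  also have "\<dots> = (\<integral>y. fejer a y * indicator {- r..r} y \<partial>lborel) + 2 / (pi * a * r)"
    using int G by (subst Bochner_Integration.integral_add) (auto simp: has_bochner_integral_iff)
  finally show ?thesis
    by simp
qed

text \<open>Explicit primitives on [0, 2 a] and evenness give the transform; the double-angle
  formula turns 1 - cos (2 a y) into the squared sine of \<open>fejer\<close>. The primitive divides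
  by y^2, hence the separate case y = 0.\<close>

lemma has_bochner_integral_triangle_cos:
  assumes "a > 0"
  shows "has_bochner_integral lborel
    (\<lambda>t. indicator {- (2 * a)..2 * a} t * (1 - \<bar>t\<bar> / (2 * a)) * cos (t * y)) (2 * pi * fejer a y)"
proof -
  let ?f = "\<lambda>t. (1 - t / (2 * a)) * cos (t * y)"
  have "has_bochner_integral lborel (\<lambda>t. ?f t * indicator {0..2 * a} t) (pi * fejer a y)"
  proof (cases "y = 0")
    case True
    have "has_bochner_integral lborel (\<lambda>t. ?f t * indicator {0..2 * a} t)
        ((2 * a - (2 * a)\<^sup>2 / (4 * a)) - (0 - 0\<^sup>2 / (4 * a)))"
      using assms True by (intro has_bochner_integral_FTC_Icc_real)
        (auto intro!: derivative_eq_intros continuous_intros simp: field_simps)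
    also have "((2 * a - (2 * a)\<^sup>2 / (4 * a)) - (0 - 0\<^sup>2 / (4 * a))) = pi * fejer a y"
      using assms True by (simp add: fejer_def field_simps power2_eq_square)
    finally show ?thesis .
  next
    case False
    let ?F = "\<lambda>t. (1 - t / (2 * a)) * sin (t * y) / y - cos (t * y) / (2 * a * y\<^sup>2)"
    have "has_bochner_integral lborel (\<lambda>t. ?f t * indicator {0..2 * a} t) (?F (2 * a) - ?F 0)"
      using assms False by (intro has_bochner_integral_FTC_Icc_real)
        (auto intro!: derivative_eq_intros continuous_intros simp: field_simps power2_eq_square)
    also have "?F (2 * a) - ?F 0 = (1 - cos (2 * (a * y))) / (2 * a * y\<^sup>2)"
      using assms by (simp add: diff_divide_distrib algebra_simps)
    also have "\<dots> = pi * fejer a y"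
      using assms False unfolding cos_double_sin by (simp add: fejer_def power2_eq_square field_simps)
    finally show ?thesis .
  qed
  then have "has_bochner_integral lborel (\<lambda>t. indicator {0..} t *\<^sub>R
      (indicator {- (2 * a)..2 * a} t * (1 - \<bar>t\<bar> / (2 * a)) * cos (t * y))) (pi * fejer a y)"
    using assms by (subst has_bochner_integral_cong[OF refl _ refl,
      where g = "\<lambda>t. ?f t * indicator {0..2 * a} t"]) (auto split: split_indicator)
  then have "has_bochner_integral lborel
      (\<lambda>t. indicator {- (2 * a)..2 * a} t * (1 - \<bar>t\<bar> / (2 * a)) * cos (t * y)) (2 *\<^sub>R (pi * fejer a y))"
    by (rule has_bochner_integral_even_function) (auto split: split_indicator)
  then show ?thesis
    by (simp only: real_scaleR_def mult.assoc)
qed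

subsection \<open>The smoothing inequality\<close>

text \<open>In the smoothing argument the lower bound for D contains a term linear in y; its kernel
  average over a symmetric window vanishes, so only the constant loss q r remains.\<close>

lemma integral_odd_fejer:
  assumes "a > 0"
  shows "integrable lborel (\<lambda>y. y * (fejer a y * indicator {- r..r} y))"
    and "(\<integral>y. y * (fejer a y * indicator {- r..r} y) \<partial>lborel) = 0"
proof -
  let ?f = "\<lambda>y. y * (fejer a y * indicator {- r..r} y)"
  show "integrable lborel ?f"
  proof (rule Bochner_Integration.integrable_bound)
    show "integrable lborel (\<lambda>y. r * fejer a y)"
      using has_bochner_integral_fejer[OF assms] by (auto simp: has_bochner_integral_iff)
    show "AE y in lborel. norm (?f y) \<le> norm (r * fejer a y)"
      using fejer_nonneg[OF assms]
      by (auto simp: abs_mult split: split_indicator intro!: mult_right_mono)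
  qed simp
  have "(\<integral>y. ?f y \<partial>lborel) = (\<integral>y. ?f (0 + (- 1) * y) \<partial>lborel)"
    by (subst lborel_integral_real_affine[of "- 1" _ 0]) simp_all
  also have "\<dots> = (\<integral>y. - ?f y \<partial>lborel)"
    by (intro Bochner_Integration.integral_cong) (auto simp: fejer_minus split: split_indicator)
  finally show "(\<integral>y. ?f y \<partial>lborel) = 0"
    by simp
qed

lemma integrable_bounded_times_fejer:
  assumes "a > 0" and [measurable]: "g \<in> borel_measurable borel" and "\<And>y. \<bar>g y\<bar> \<le> c"
  shows "integrable lborel (\<lambda>y. g y * fejer a y)"
proof (rule Bochner_Integration.integrable_bound)
  show "integrable lborel (\<lambda>y. c * fejer a y)"
    using has_bochner_integral_fejer[OF assms(1)] by (auto simp: has_bochner_integral_iff)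
  show "AE y in lborel. norm (g y * fejer a y) \<le> norm (c * fejer a y)"
    using fejer_nonneg[OF assms(1)] order_trans[OF assms(3) abs_ge_self]
    by (auto simp: abs_mult intro!: AE_I2 mult_right_mono)
qed simp

text \<open>The convolution is evaluated at x + r, so that the window |y| <= r looks only to the
  right of x, where D is at least D x - q (r - y). Off the window only D >= - \<Delta> is known.
  Here \<open>p\<close> is a lower bound for the kernel mass of the window.\<close>

lemma smoothing_one_sided:
  fixes D :: "real \<Rightarrow> real"
  assumes "a > 0" "r > 0" and [measurable]: "D \<in> borel_measurable borel"
    and decrease: "\<And>x y. x \<le> y \<Longrightarrow> D x - D y \<le> q * (y - x)"
    and bound: "\<And>x. \<bar>D x\<bar> \<le> \<Delta>"
    and smooth: "\<And>x. (\<integral>y. D (x - y) * fejer a y \<partial>lborel) \<le> \<eta>"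
    and "\<eta> \<ge> 0" and p: "0 < p" "p \<le> 1 - 2 / (pi * a * r)"
  shows "D x \<le> (\<eta> + \<Delta>) / p - \<Delta> + q * r"
proof -
  let ?K = "fejer a" and ?I = "\<lambda>y. indicator {- r..r} y :: real" and ?c = "D x - q * r + \<Delta>"
  let ?P = "\<integral>y. ?K y * ?I y \<partial>lborel"
  have K: "integrable lborel ?K" "(\<integral>y. ?K y \<partial>lborel) = 1"
    using has_bochner_integral_fejer[OF assms(1)] by (auto simp: has_bochner_integral_iff)
  have KI: "integrable lborel (\<lambda>y. ?K y * ?I y)"
    using K by (intro integrable_real_mult_indicator) auto
  note odd = integral_odd_fejer[OF assms(1), of r]
  \<comment> \<open>Adding \<Delta> inside the window and subtracting \<Delta> times the full kernel
    encodes both lower bounds in one integrand.\<close>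
  have "?c * ?P - \<Delta> =
      (\<integral>y. ?c * (?K y * ?I y) + q * (y * (?K y * ?I y)) - \<Delta> * ?K y \<partial>lborel)"
    using K KI odd by simp
  also have "\<dots> \<le> (\<integral>y. D (x + r - y) * ?K y \<partial>lborel)"
  proof (rule integral_mono)
    show "integrable lborel (\<lambda>y. ?c * (?K y * ?I y) + q * (y * (?K y * ?I y)) - \<Delta> * ?K y)"
      using K KI odd by (auto intro!: Bochner_Integration.integrable_diff Bochner_Integration.integrable_add)
    show "integrable lborel (\<lambda>y. D (x + r - y) * ?K y)"
      by (rule integrable_bounded_times_fejer[OF assms(1) _ bound]) measurable
    fix y
    show "?c * (?K y * ?I y) + q * (y * (?K y * ?I y)) - \<Delta> * ?K y \<le> D (x + r - y) * ?K y"
    proof (cases "y \<in> {- r..r}")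
      case True
      then have "D x - D (x + r - y) \<le> q * (r - y)"
        using decrease[of x "x + r - y"] by simp
      then have "(D x - q * (r - y)) * ?K y \<le> D (x + r - y) * ?K y"
        using fejer_nonneg[OF assms(1), of y] by (intro mult_right_mono) auto
      then show ?thesis
        using True by (simp add: algebra_simps)
    next
      case False
      have "- \<Delta> * ?K y \<le> D (x + r - y) * ?K y"
        using bound[of "x + r - y"] fejer_nonneg[OF assms(1), of y]
        by (intro mult_right_mono) auto
      then show ?thesis
        using False by simp
    qed
  qed
  also have "\<dots> \<le> \<eta>"
    by (rule smooth)
  finally have *: "?c * ?P \<le> \<eta> + \<Delta>"
    by simp
  have "\<Delta> \<ge> 0"
    using bound[of 0] by simp
  have "?c \<le> (\<eta> + \<Delta>) / p"
  \<comment> \<open>Replacing the true mass by the smaller \<open>p\<close> is legitimate only for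
    nonnegative \<open>?c\<close>; otherwise the right-hand side, being nonnegative, already
    dominates.\<close>
  proof (cases "?c \<ge> 0")
    case True
    have "?c * p \<le> ?c * ?P"
      using True p(2) fejer_tail_integral[OF assms(1,2)] by (intro mult_left_mono) auto
    with * show ?thesis
      using p(1) by (simp add: pos_le_divide_eq)
  next
    case False
    moreover have "(\<eta> + \<Delta>) / p \<ge> 0"
      using \<open>\<eta> \<ge> 0\<close> \<open>\<Delta> \<ge> 0\<close> p(1) by simp
    ultimately show ?thesis
      by linarith
  qed
  then show ?thesis
    by simp
qed

lemma smoothing_inequality:
  fixes D :: "real \<Rightarrow> real"
  assumes "a > 0" "b > 1" and [measurable]: "D \<in> borel_measurable borel"
    and decrease: "\<And>x y. x \<le> y \<Longrightarrow> D x - D y \<le> q * (y - x)"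
    and bound: "\<And>x. \<bar>D x\<bar> \<le> c"
    and smooth: "\<And>x. \<bar>\<integral>y. D (x - y) * fejer a y \<partial>lborel\<bar> \<le> \<eta>"
  shows "\<bar>D x\<bar> \<le> b * \<eta> + q * (2 * b * (b + 1) / (pi * a * (b - 1)))"
proof -
  define \<Delta> where "\<Delta> = (SUP x. \<bar>D x\<bar>)"
  \<comment> \<open>Chosen so that the tail bound 2 / (pi a r) equals 1 - p exactly, with p = (1 +
    1/b) / 2.\<close>
  define r where "r = 4 * b / (pi * a * (b - 1))"
  define p where "p = (b + 1) / (2 * b)"
  have bdd: "bdd_above (range (\<lambda>x. \<bar>D x\<bar>))"
    using bound by (auto intro!: bdd_aboveI)
  have \<Delta>: "\<bar>D x\<bar> \<le> \<Delta>" for x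
    unfolding \<Delta>_def by (rule cSUP_upper[OF _ bdd]) simp
  have r: "r > 0"
    using assms(1,2) by (simp add: r_def)
  have p: "0 < p" "p \<le> 1 - 2 / (pi * a * r)"
    using assms(1,2) by (simp_all add: p_def r_def field_simps)
  have \<eta>: "\<eta> \<ge> 0"
    using smooth[of 0] by linarith
  have upper: "D x \<le> (\<eta> + \<Delta>) / p - \<Delta> + q * r" for x
    using smooth by (intro smoothing_one_sided[OF assms(1) r assms(3) decrease \<Delta> _ \<eta> p])
      (auto simp: abs_le_iff)
  \<comment> \<open>The function x -> - D (- x) flips sign and orientation together, so it obeys the
    same one-sided decrease; evenness of the kernel transfers the smoothing bound.\<close>
  have lower: "- D (- x) \<le> (\<eta> + \<Delta>) / p - \<Delta> + q * r" for x
  proof (rule smoothing_one_sided[where D = "\<lambda>x. - D (- x)", OF assms(1) r _ _ _ _ \<eta> p])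
    show "- D (- x) - - D (- y) \<le> q * (y - x)" if "x \<le> y" for x y
      using decrease[of "- y" "- x"] that by simp
    show "\<bar>- D (- x)\<bar> \<le> \<Delta>" for x
      using \<Delta> by simp
    fix x
    have "(\<integral>y. - D (- (x - y)) * fejer a y \<partial>lborel) =
        (\<integral>y. - D (- (x - (0 + (- 1) * y))) * fejer a (0 + (- 1) * y) \<partial>lborel)"
      by (subst lborel_integral_real_affine[of "- 1" _ 0]) simp_all
    also have "\<dots> = - (\<integral>y. D (- x - y) * fejer a y \<partial>lborel)"
      by (simp add: fejer_minus)
    also have "\<dots> \<le> \<eta>"
      using smooth[of "- x"] by linarith
    finally show "(\<integral>y. - D (- (x - y)) * fejer a y \<partial>lborel) \<le> \<eta>" .
  qed measurable
  have "\<bar>D x\<bar> \<le> (\<eta> + \<Delta>) / p - \<Delta> + q * r" for x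
    using upper[of x] lower[of "- x"] by simp
  \<comment> \<open>The bound is uniform in x, so it passes to the supremum and \<Delta> occurs on
    both sides. Collecting terms leaves the positive factor 2 p - 1 = 1 / b.\<close>
  then have "\<Delta> \<le> (\<eta> + \<Delta>) / p - \<Delta> + q * r"
    unfolding \<Delta>_def by (intro cSUP_least) auto
  then have "\<Delta> * p \<le> ((\<eta> + \<Delta>) / p - \<Delta> + q * r) * p"
    using p(1) by (intro mult_right_mono) auto
  also have "\<dots> = \<eta> + \<Delta> - \<Delta> * p + q * r * p"
    using p(1) by (simp add: field_simps)
  finally have "\<Delta> * (2 * p - 1) \<le> \<eta> + q * r * p"
    by (simp add: algebra_simps)
  moreover have "2 * p - 1 = 1 / b"
    using assms(2) by (simp add: p_def field_simps)
  ultimately have "\<Delta> / b \<le> \<eta> + q * r * p"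
    by simp
  then have "\<Delta> \<le> (\<eta> + q * r * p) * b"
    using assms(2) by (simp add: pos_divide_le_eq)
  also have "\<dots> = b * \<eta> + q * (r * p * b)"
    by (simp add: algebra_simps)
  also have "r * p * b = 2 * b * (b + 1) / (pi * a * (b - 1))"
    using assms(1,2) by (simp add: r_def p_def field_simps)
  finally show ?thesis
    using \<Delta>[of x] by linarith
qed

subsection \<open>Fourier transform of a difference of distribution functions\<close>

lemma has_bochner_integral_iexp_Icc:
  assumes "t \<noteq> 0" "a \<le> b"
  shows "has_bochner_integral lborel (\<lambda>u. indicator {a..b} u *\<^sub>R iexp (t * u))
    ((iexp (t * b) - iexp (t * a)) / (\<i> * t))"
proof -
  have "has_bochner_integral lborel (\<lambda>u. indicator {a..b} u *\<^sub>R iexp (t * u))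
      (iexp (t * b) / (\<i> * t) - iexp (t * a) / (\<i> * t))"
  proof (rule has_bochner_integral_FTC_Icc[OF assms(2)])
    fix u
    have "((\<lambda>z. exp (\<i> * t * z) / (\<i> * t)) has_field_derivative exp (\<i> * t * of_real u)) (at (of_real u))"
      using assms(1) by (auto intro!: derivative_eq_intros)
    from has_vector_derivative_real_field[OF this]
    show "((\<lambda>u. iexp (t * u) / (\<i> * t)) has_vector_derivative iexp (t * u)) (at u within {a..b})"
      by (simp add: mult.assoc has_vector_derivative_at_within)
  qed (auto intro!: continuous_intros)
  then show ?thesis
    by (simp add: diff_divide_distrib)
qed

text \<open>
  Subtracting the step at \<open>0\<close> makes the distribution function integrable; the step cancels in
  the difference of two distribution functions.
\<close>

definition centered_step :: "real \<Rightarrow> real \<Rightarrow> real"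
  where "centered_step z u = (if z < u then 1 else 0) - (if 0 < u then 1 else 0)"

lemma centered_step_measurable [measurable (raw)]:
  assumes [measurable]: "f \<in> borel_measurable M" "g \<in> borel_measurable M"
  shows "(\<lambda>w. centered_step (f w) (g w)) \<in> borel_measurable M"
  unfolding centered_step_def by measurable

text \<open>The step differs from 0 exactly between 0 and z, so a finite first absolute moment of z
  controls the double integral in Fubini's theorem.\<close>

lemma has_bochner_integral_abs_centered_step:
  "has_bochner_integral lborel (\<lambda>u. \<bar>centered_step z u\<bar>) \<bar>z\<bar>"
proof -
  have "has_bochner_integral lborel (indicator {min z 0<..max z 0}) (measure lborel {min z 0<..max z 0})"
    by (intro has_bochner_integral_real_indicator) (auto simp: emeasure_lborel_Ioc)
  then show ?thesis
    by (rule has_bochner_integral_cong[THEN iffD1, rotated 3])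
      (auto simp: centered_step_def split: split_indicator)
qed

lemma integral_centered_step_iexp:
  assumes "t \<noteq> 0"
  shows "(\<integral>u. centered_step z u *\<^sub>R iexp (t * u) \<partial>lborel) = (1 - iexp (t * z)) / (\<i> * t)"
proof (cases "z \<le> 0")
  case True
  have "(\<integral>u. centered_step z u *\<^sub>R iexp (t * u) \<partial>lborel) =
      (\<integral>u. indicator {z..0} u *\<^sub>R iexp (t * u) \<partial>lborel)"
    using AE_lborel_singleton[of z] True
    by (intro integral_cong_AE)
      (auto simp: centered_step_def split: split_indicator elim!: eventually_mono)
  then show ?thesis
    using has_bochner_integral_iexp_Icc[OF assms True] by (simp add: has_bochner_integral_iff)
next
  case False
  then have z: "0 \<le> z"
    by simp
  have "(\<integral>u. centered_step z u *\<^sub>R iexp (t * u) \<partial>lborel) =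
      (\<integral>u. - (indicator {0..z} u *\<^sub>R iexp (t * u)) \<partial>lborel)"
    using AE_lborel_singleton[of 0] False
    by (intro integral_cong_AE)
      (auto simp: centered_step_def split: split_indicator elim!: eventually_mono)
  then show ?thesis
    using has_bochner_integral_iexp_Icc[OF assms z]
    by (simp add: has_bochner_integral_iff minus_divide_left)
qed

text \<open>\<open>E u\<close> is the \<mu>-average of \<open>centered_step z u\<close>, so Fubini
  reduces its Fourier transform to that of a single step, without integration by parts for Stieltjes
  integrals.\<close>

lemma fourier_centered_distribution:
  fixes \<mu> :: "real measure"
  assumes "real_distribution \<mu>" and moment: "integrable \<mu> (\<lambda>z. z)"
  defines "E \<equiv> \<lambda>u. measure \<mu> {..<u} - (if 0 < u then 1 else 0)"
  shows "integrable lborel E"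
    and "t \<noteq> 0 \<Longrightarrow> (\<integral>u. E u *\<^sub>R iexp (t * u) \<partial>lborel) = (1 - char \<mu> t) / (\<i> * t)"
proof -
  interpret real_distribution \<mu>
    by fact
  interpret pair_sigma_finite \<mu> lborel
    by (intro pair_sigma_finite.intro sigma_finite_measure_axioms lborel.sigma_finite_measure_axioms)
  have fubini: "integrable (\<mu> \<Otimes>\<^sub>M lborel) (\<lambda>(z, u). centered_step z u *\<^sub>R iexp (t * u))" for t
  proof (rule Fubini_integrable)
    have "(\<integral>u. norm (centered_step z u *\<^sub>R iexp (t * u)) \<partial>lborel) = \<bar>z\<bar>" for z
      using has_bochner_integral_abs_centered_step[of z] by (simp add: has_bochner_integral_iff)
    then show "integrable \<mu> (\<lambda>z. \<integral>u. norm (case (z, u) of (z, u) \<Rightarrow> centered_step z u *\<^sub>R iexp (t * u)) \<partial>lborel)"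
      using moment by simp
    have "integrable lborel (\<lambda>u. centered_step z u *\<^sub>R iexp (t * u))" for z
    proof (rule Bochner_Integration.integrable_bound)
      show "integrable lborel (\<lambda>u. \<bar>centered_step z u\<bar>)"
        using has_bochner_integral_abs_centered_step[of z] by (simp add: has_bochner_integral_iff)
      show "AE u in lborel. norm (centered_step z u *\<^sub>R iexp (t * u)) \<le> norm \<bar>centered_step z u\<bar>"
        by simp
    qed measurable
    then show "AE z in \<mu>. integrable lborel (\<lambda>u. case (z, u) of (z, u) \<Rightarrow> centered_step z u *\<^sub>R iexp (t * u))"
      by simp
  qed measurable
  have E: "(\<integral>z. centered_step z u *\<^sub>R iexp (t * u) \<partial>\<mu>) = E u *\<^sub>R iexp (t * u)" for u t
  proof -
    have "(\<integral>z. centered_step z u \<partial>\<mu>) = (\<integral>z. indicator {..<u} z - (if 0 < u then 1 else 0) \<partial>\<mu>)"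
      by (intro Bochner_Integration.integral_cong) (auto simp: centered_step_def split: split_indicator)
    also have "\<dots> = E u"
      using integrable_const_bound[of "indicator {..<u} :: real \<Rightarrow> real" 1]
      by (subst Bochner_Integration.integral_diff) (auto simp: E_def prob_space[simplified])
    finally have "(\<integral>z. centered_step z u \<partial>\<mu>) = E u" .
    moreover have "integrable \<mu> (\<lambda>z. centered_step z u)"
      by (intro integrable_const_bound[of _ 1]) (auto simp: centered_step_def)
    ultimately show ?thesis
      by (simp only: integral_scaleR_left)
  qed
  \<comment> \<open>At t = 0 the exponential is 1, so integrability of \<open>E\<close> is a special
    case of the Fubini argument.\<close>
  have "integrable lborel (\<lambda>u. E u *\<^sub>R iexp (0 * u))"
    using integrable_snd[OF fubini[of 0]] by (simp only: E)
  then show "integrable lborel E"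
    by (simp add: scaleR_conv_of_real complex_of_real_integrable_eq)
  assume "t \<noteq> 0"
  have "(\<integral>u. E u *\<^sub>R iexp (t * u) \<partial>lborel) =
      (\<integral>z. (\<integral>u. centered_step z u *\<^sub>R iexp (t * u) \<partial>lborel) \<partial>\<mu>)"
    using Fubini_integral[OF fubini[of t]] by (simp only: E)
  also have "\<dots> = (\<integral>z. (1 - iexp (t * z)) / (\<i> * t) \<partial>\<mu>)"
    by (simp only: integral_centered_step_iexp[OF \<open>t \<noteq> 0\<close>])
  also have "\<dots> = (1 - char \<mu> t) / (\<i> * t)"
  proof -
    have "integrable \<mu> (\<lambda>z. iexp (t * z))"
      by (intro integrable_iexp) auto
    then show ?thesis
      by (simp add: char_def prob_space[simplified])
  qed
  finally show "(\<integral>u. E u *\<^sub>R iexp (t * u) \<partial>lborel) = (1 - char \<mu> t) / (\<i> * t)" .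
qed

lemma fourier_distribution_difference:
  fixes \<mu> \<nu> :: "real measure"
  assumes "real_distribution \<mu>" "integrable \<mu> (\<lambda>z. z)" "real_distribution \<nu>" "integrable \<nu> (\<lambda>z. z)"
  defines "D \<equiv> \<lambda>u. measure \<mu> {..<u} - measure \<nu> {..<u}"
  shows "integrable lborel D"
    and "t \<noteq> 0 \<Longrightarrow> (\<integral>u. D u *\<^sub>R iexp (t * u) \<partial>lborel) = (char \<nu> t - char \<mu> t) / (\<i> * t)"
proof -
  let ?E = "\<lambda>\<mu> u. measure \<mu> {..<u} - (if 0 < u then 1 else 0) :: real"
  note \<mu> = fourier_centered_distribution[OF assms(1,2)]
  note \<nu> = fourier_centered_distribution[OF assms(3,4)]
  have D: "D = (\<lambda>u. ?E \<mu> u - ?E \<nu> u)"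
    by (simp add: D_def)
  show "integrable lborel D"
    unfolding D by (intro Bochner_Integration.integrable_diff \<mu>(1) \<nu>(1))
  have iexp: "integrable lborel (\<lambda>u. f u *\<^sub>R iexp (t * u))" if "integrable lborel f" for f :: "real \<Rightarrow> real"
    by (rule Bochner_Integration.integrable_bound[OF that]) (use that in auto)
  assume "t \<noteq> 0"
  have "(\<integral>u. D u *\<^sub>R iexp (t * u) \<partial>lborel) =
      (\<integral>u. ?E \<mu> u *\<^sub>R iexp (t * u) - ?E \<nu> u *\<^sub>R iexp (t * u) \<partial>lborel)"
    unfolding D scaleR_diff_left ..
  also have "\<dots> = (1 - char \<mu> t) / (\<i> * t) - (1 - char \<nu> t) / (\<i> * t)"
    using Bochner_Integration.integral_diff[OF iexp[OF \<mu>(1)] iexp[OF \<nu>(1)]]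
    by (simp only: \<mu>(2)[OF \<open>t \<noteq> 0\<close>] \<nu>(2)[OF \<open>t \<noteq> 0\<close>])
  also have "\<dots> = (char \<nu> t - char \<mu> t) / (\<i> * t)"
    by (simp add: diff_divide_distrib[symmetric])
  finally show "(\<integral>u. D u *\<^sub>R iexp (t * u) \<partial>lborel) = (char \<nu> t - char \<mu> t) / (\<i> * t)" .
qed

lemma fejer_convolution_bound:
  fixes D W :: "real \<Rightarrow> real"
  assumes "a > 0" and D: "integrable lborel D" and W: "integrable lborel W" "\<And>t. 0 \<le> W t"
    and fourier: "\<And>t. t \<noteq> 0 \<Longrightarrow> \<bar>t\<bar> \<le> 2 * a \<Longrightarrow> cmod (\<integral>u. D u *\<^sub>R iexp (t * u) \<partial>lborel) \<le> W t"
  shows "\<bar>\<integral>y. D (x - y) * fejer a y \<partial>lborel\<bar> \<le> (\<integral>t. W t \<partial>lborel) / (2 * pi)"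
proof -
  define \<tau> where "\<tau> t = indicator {- (2 * a)..2 * a} t * (1 - \<bar>t\<bar> / (2 * a))" for t
  have [measurable]: "\<tau> \<in> borel_measurable borel"
    unfolding \<tau>_def by measurable
  have [measurable]: "D \<in> borel_measurable borel"
    using D by auto
  have \<tau>: "0 \<le> \<tau> t" "\<tau> t \<le> 1" for t
    using assms(1) by (auto simp: \<tau>_def split: split_indicator)
  have int_\<tau>: "integrable lborel \<tau>"
    using has_bochner_integral_triangle_cos[OF assms(1), of 0]
    by (simp add: \<tau>_def[abs_def] has_bochner_integral_iff)
  have tri: "(\<integral>t. \<tau> t * cos (t * y) \<partial>lborel) = 2 * pi * fejer a y" for y
    using has_bochner_integral_triangle_cos[OF assms(1), of y]
    by (simp add: \<tau>_def[abs_def] has_bochner_integral_iff)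
  have "integrable (lborel \<Otimes>\<^sub>M lborel) (\<lambda>(u, t). D u * \<tau> t)"
  proof (rule lborel_pair.Fubini_integrable)
    show "integrable lborel (\<lambda>u. \<integral>t. norm (case (u, t) of (u, t) \<Rightarrow> D u * \<tau> t) \<partial>lborel)"
      using D by (simp add: abs_mult)
    show "AE u in lborel. integrable lborel (\<lambda>t. case (u, t) of (u, t) \<Rightarrow> D u * \<tau> t)"
      using int_\<tau> by simp
  qed measurable
  then have fubini: "integrable (lborel \<Otimes>\<^sub>M lborel) (\<lambda>(u, t). D u * (\<tau> t * cos (t * (x - u))))"
  proof (rule Bochner_Integration.integrable_bound)
    have "\<bar>D u * (\<tau> t * cos (t * (x - u)))\<bar> \<le> \<bar>D u * \<tau> t\<bar>" for u t
      using mult_left_mono[OF abs_cos_le_one[of "t * (x - u)"], of "\<bar>D u * \<tau> t\<bar>"] by (simp add: abs_mult)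
    then show "AE p in lborel \<Otimes>\<^sub>M lborel. norm (case p of (u, t) \<Rightarrow> D u * (\<tau> t * cos (t * (x - u))))
        \<le> norm (case p of (u, t) \<Rightarrow> D u * \<tau> t)"
      by (simp add: case_prod_beta)
  qed measurable
  have inner: "\<bar>\<integral>u. D u * (\<tau> t * cos (t * (x - u))) \<partial>lborel\<bar> \<le> W t" if "t \<noteq> 0" for t
  proof (cases "\<bar>t\<bar> \<le> 2 * a")
    case True
    have int: "integrable lborel (\<lambda>u. D u *\<^sub>R iexp (t * u))"
      by (rule Bochner_Integration.integrable_bound[OF D]) auto
    \<comment> \<open>cos (t (x - u)) is the real part of exp (- i t x) exp (i t u), and the factor
      depending on x has modulus 1.\<close>
    have "(\<integral>u. D u * (\<tau> t * cos (t * (x - u))) \<partial>lborel) =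
        (\<integral>u. \<tau> t * Re (iexp (- t * x) * (D u *\<^sub>R iexp (t * u))) \<partial>lborel)"
    proof (rule Bochner_Integration.integral_cong[OF refl])
      fix u
      show "D u * (\<tau> t * cos (t * (x - u))) = \<tau> t * Re (iexp (- t * x) * (D u *\<^sub>R iexp (t * u)))"
        by (simp add: Re_exp Im_exp right_diff_distrib cos_diff algebra_simps)
    qed
    also have "\<dots> = \<tau> t * Re (iexp (- t * x) * (\<integral>u. D u *\<^sub>R iexp (t * u) \<partial>lborel))"
      by (simp only: integral_mult_right_zero integral_Re[OF integrable_mult_right[OF int]])
    finally have "\<bar>\<integral>u. D u * (\<tau> t * cos (t * (x - u))) \<partial>lborel\<bar> =
        \<tau> t * \<bar>Re (iexp (- t * x) * (\<integral>u. D u *\<^sub>R iexp (t * u) \<partial>lborel))\<bar>"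
      using \<tau>(1)[of t] by (simp add: abs_mult)
    also have "\<dots> \<le> 1 * cmod (iexp (- t * x) * (\<integral>u. D u *\<^sub>R iexp (t * u) \<partial>lborel))"
      using \<tau>[of t] by (intro mult_mono abs_Re_le_cmod) auto
    also have "\<dots> \<le> W t"
      using fourier[OF that True] by (simp add: norm_mult del: of_real_mult)
    finally show ?thesis .
  next
    case False
    then have "\<tau> t = 0"
      by (auto simp: \<tau>_def split: split_indicator)
    then show ?thesis
      using W(2) by simp
  qed
  have "(\<integral>y. D (x - y) * fejer a y \<partial>lborel) = (\<integral>u. D u * fejer a (x - u) \<partial>lborel)"
    by (subst lborel_integral_real_affine[of "- 1" _ x]) simp_all
  also have "\<dots> = (\<integral>u. (\<integral>t. D u * (\<tau> t * cos (t * (x - u))) \<partial>lborel) / (2 * pi) \<partial>lborel)"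
    by (simp add: tri)
  also have "\<dots> = (\<integral>u. (\<integral>t. D u * (\<tau> t * cos (t * (x - u))) \<partial>lborel) \<partial>lborel) / (2 * pi)"
    by simp
  also have "(\<integral>u. (\<integral>t. D u * (\<tau> t * cos (t * (x - u))) \<partial>lborel) \<partial>lborel) =
      (\<integral>t. (\<integral>u. D u * (\<tau> t * cos (t * (x - u))) \<partial>lborel) \<partial>lborel)"
    by (rule lborel_pair.Fubini_integral[OF fubini, symmetric])
  finally have "\<bar>\<integral>y. D (x - y) * fejer a y \<partial>lborel\<bar> =
      \<bar>\<integral>t. (\<integral>u. D u * (\<tau> t * cos (t * (x - u))) \<partial>lborel) \<partial>lborel\<bar> / (2 * pi)"
    by (simp add: abs_divide)
  also have "\<dots> \<le> (\<integral>t. W t \<partial>lborel) / (2 * pi)"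
  proof (rule divide_right_mono)
    have "\<bar>\<integral>t. (\<integral>u. D u * (\<tau> t * cos (t * (x - u))) \<partial>lborel) \<partial>lborel\<bar> \<le>
        (\<integral>t. \<bar>\<integral>u. D u * (\<tau> t * cos (t * (x - u))) \<partial>lborel\<bar> \<partial>lborel)"
      by (rule integral_abs_bound)
    also have "\<dots> \<le> (\<integral>t. W t \<partial>lborel)"
    proof (rule integral_mono_AE)
      show "integrable lborel (\<lambda>t. \<bar>\<integral>u. D u * (\<tau> t * cos (t * (x - u))) \<partial>lborel\<bar>)"
        by (rule integrable_abs[OF lborel_pair.integrable_snd[OF fubini]])
      show "AE t in lborel. \<bar>\<integral>u. D u * (\<tau> t * cos (t * (x - u))) \<partial>lborel\<bar> \<le> W t"
        using AE_lborel_singleton[of 0] by (rule eventually_mono) (rule inner)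
    qed (rule W(1))
    finally show "\<bar>\<integral>t. (\<integral>u. D u * (\<tau> t * cos (t * (x - u))) \<partial>lborel) \<partial>lborel\<bar> \<le> (\<integral>t. W t \<partial>lborel)" .
  qed simp
  finally show ?thesis .
qed

subsection \<open>Characteristic functions and third moments\<close>

lemma cos_le_cubic: "cos (x::real) \<le> 1 - x\<^sup>2 / 2 + \<bar>x\<bar> ^ 3 / 6"
proof -
  have "Re (iexp x - (\<Sum>k\<le>2. (\<i> * x) ^ k / fact k)) \<le> \<bar>x\<bar> ^ Suc 2 / fact (Suc 2)"
    by (rule order_trans[OF complex_Re_le_cmod iexp_approx1])
  then show ?thesis
    by (simp add: numeral_eq_Suc Re_exp power2_eq_square)
qed

lemma mixed_cubes_le:
  fixes p q :: real
  assumes "0 \<le> p" "0 \<le> q"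
  shows "p * q\<^sup>2 + q * p\<^sup>2 \<le> p ^ 3 + q ^ 3"
proof -
  have "0 \<le> (p + q) * (p - q)\<^sup>2"
    using assms by simp
  then show ?thesis
    by (simp add: power3_eq_cube power2_eq_square algebra_simps)
qed

text \<open>
  For independent copies \<open>x\<close>, \<open>y\<close> of a centred variable the last two terms have mean zero, so the
  third absolute moment of \<open>x - y\<close> is at most \<open>4\<close> (rather than \<open>8\<close>) times that of \<open>x\<close>.
\<close>

lemma abs_diff_cubed_le:
  "\<bar>x - y :: real\<bar> ^ 3 \<le> 2 * \<bar>x\<bar> ^ 3 + 2 * \<bar>y\<bar> ^ 3 - 2 * x * \<bar>x\<bar> * y - 2 * x * (y * \<bar>y\<bar>)"
proof -
  have "\<bar>x - y\<bar> ^ 3 = \<bar>x - y\<bar> * (x - y)\<^sup>2"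
    by (simp add: power3_eq_cube power2_eq_square)
  also have "\<dots> \<le> (\<bar>x\<bar> + \<bar>y\<bar>) * (x - y)\<^sup>2"
    by (intro mult_right_mono) auto
  also have "\<dots> = \<bar>x\<bar> ^ 3 + \<bar>y\<bar> ^ 3 + (\<bar>x\<bar> * \<bar>y\<bar>\<^sup>2 + \<bar>y\<bar> * \<bar>x\<bar>\<^sup>2) - 2 * x * \<bar>x\<bar> * y - 2 * x * (y * \<bar>y\<bar>)"
    by (simp add: power3_eq_cube power2_eq_square algebra_simps)
  also have "\<bar>x\<bar> * \<bar>y\<bar>\<^sup>2 + \<bar>y\<bar> * \<bar>x\<bar>\<^sup>2 \<le> \<bar>x\<bar> ^ 3 + \<bar>y\<bar> ^ 3"
    by (rule mixed_cubes_le) auto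
  finally show ?thesis
    by simp
qed

lemma abs_exp_minus_linear_le:
  fixes w :: real
  assumes "0 \<le> w"
  shows "\<bar>exp (- w) - (1 - w)\<bar> \<le> w\<^sup>2 / 2"
proof -
  have sq: "0 \<le> 1 - w + w\<^sup>2 / 2"
    using zero_le_power2[of "1 - w"] by (simp add: power2_diff)
  \<comment> \<open>The product equals 1 + w^4 / 4; bounding its second factor by exp w gives the
    upper estimate for exp (- w).\<close>
  have "1 \<le> (1 - w + w\<^sup>2 / 2) * (1 + w + w\<^sup>2 / 2)"
    using zero_le_power2[of "w * w"] by (simp add: power2_eq_square algebra_simps)
  also have "\<dots> \<le> (1 - w + w\<^sup>2 / 2) * exp w"
    using sq by (intro mult_left_mono exp_lower_Taylor_quadratic assms)
  finally have "exp (- w) \<le> 1 - w + w\<^sup>2 / 2"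
    by (simp add: exp_minus field_simps)
  moreover have "1 - w \<le> exp (- w)"
    using exp_ge_add_one_self[of "- w"] by simp
  ultimately show ?thesis
    by (simp add: abs_le_iff)
qed

section \<open>Estimates for a single centred summand\<close>

locale third_moment = real_distribution M for M :: "real measure" +
  assumes integrable_abs3: "integrable M (\<lambda>x. \<bar>x\<bar> ^ 3)"
    and mean_zero: "(\<integral>x. x \<partial>M) = 0"
begin

abbreviation v where "v \<equiv> \<integral>x. x\<^sup>2 \<partial>M"
abbreviation b3 where "b3 \<equiv> \<integral>x. \<bar>x\<bar> ^ 3 \<partial>M"

lemma integrable_power_le3: "k \<le> 3 \<Longrightarrow> integrable M (\<lambda>x. x ^ k)"
proof (rule Bochner_Integration.integrable_bound)
  assume "k \<le> 3"
  show "integrable M (\<lambda>x. 1 + \<bar>x\<bar> ^ 3)"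
    using integrable_abs3 by simp
  show "AE x in M. norm (x ^ k) \<le> norm (1 + \<bar>x\<bar> ^ 3)"
  proof (rule AE_I2)
    fix x :: real
    have "\<bar>x\<bar> ^ k \<le> 1 + \<bar>x\<bar> ^ 3"
    proof (cases "\<bar>x\<bar> \<le> 1")
      case True
      then show ?thesis
        using power_le_one[of "\<bar>x\<bar>" k] by (simp add: add_increasing2)
    next
      case False
      then show ?thesis
        using power_increasing[OF \<open>k \<le> 3\<close>, of "\<bar>x\<bar>"] by linarith
    qed
    then show "norm (x ^ k) \<le> norm (1 + \<bar>x\<bar> ^ 3)"
      by (simp add: power_abs)
  qed
qed simp

lemma integrable_id: "integrable M (\<lambda>x. x)"
  using integrable_power_le3[of 1] by simp

lemma integrable_square: "integrable M (\<lambda>x. x\<^sup>2)"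
  by (rule integrable_power_le3) simp

lemma integrable_times_abs: "integrable M (\<lambda>x. x * \<bar>x\<bar>)"
  by (rule Bochner_Integration.integrable_bound[OF integrable_square]) (auto simp: power2_eq_square abs_mult)

lemma v_nonneg: "0 \<le> v"
  by simp

lemma b3_nonneg: "0 \<le> b3"
  by simp

text \<open>Lyapunov's inequality between the second and third moments, obtained by integrating a
  pointwise cubic inequality that is sharp at |x| = sqrt v.\<close>

lemma sqrt_v_cubed_le: "sqrt v ^ 3 \<le> b3"
proof -
  let ?s = "sqrt v"
  have pointwise: "3 * ?s * x\<^sup>2 \<le> 2 * \<bar>x\<bar> ^ 3 + ?s ^ 3" for x
  proof -
    have "0 \<le> (2 * \<bar>x\<bar> + ?s) * (\<bar>x\<bar> - ?s)\<^sup>2"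
      by simp
    then show ?thesis
      by (simp add: power3_eq_cube power2_eq_square algebra_simps)
  qed
  have "(\<integral>x. 3 * ?s * x\<^sup>2 \<partial>M) \<le> (\<integral>x. 2 * \<bar>x\<bar> ^ 3 + ?s ^ 3 \<partial>M)"
    using integrable_square integrable_abs3 by (intro integral_mono pointwise) auto
  then have "3 * (?s * v) \<le> 2 * b3 + ?s ^ 3"
    using integrable_square integrable_abs3 prob_space by (simp add: mult.assoc)
  moreover have "?s * v = ?s ^ 3"
    using real_sqrt_pow2[OF v_nonneg] by (simp add: power3_eq_cube power2_eq_square)
  ultimately show ?thesis
    by simp
qed

text \<open>The squared modulus is the mean of cos (t (x - y)) over two independent copies, carried
  out as an iterated integral. The cubic cosine bound contributes 1/6 and the symmetrized third
  moment 4, giving 2/3.\<close>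

lemma cmod_char_squared_le: "(cmod (char M t))\<^sup>2 \<le> 1 - v * t\<^sup>2 + 2 / 3 * b3 * \<bar>t\<bar> ^ 3"
proof -
  let ?C = "\<integral>x. cos (t * x) \<partial>M" and ?S = "\<integral>x. sin (t * x) \<partial>M"
    and ?m = "\<integral>x. x * \<bar>x\<bar> \<partial>M"
  have int: "integrable M (\<lambda>x. cos (t * x))" "integrable M (\<lambda>x. sin (t * x))"
    by (intro integrable_const_bound[of _ 1]; simp)+
  note ints = int integrable_id integrable_square integrable_times_abs integrable_abs3
  have char: "char M t = Complex ?C ?S"
  proof -
    have "integrable M (\<lambda>x. iexp (t * x))"
      by (intro integrable_iexp) auto
    then show ?thesis
      unfolding char_def
      by (intro complex_eqI) (simp_all add: integral_Re[symmetric] integral_Im[symmetric] Re_exp Im_exp del: integral_Re integral_Im)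
  qed
  have inner: "cos (t * x) * ?C + sin (t * x) * ?S \<le>
      1 - t\<^sup>2 / 2 * (x\<^sup>2 + v) + \<bar>t\<bar> ^ 3 / 6 * (2 * \<bar>x\<bar> ^ 3 + 2 * b3 - 2 * x * ?m)" for x
  proof -
    have "cos (t * x) * ?C + sin (t * x) * ?S =
        (\<integral>y. cos (t * x) * cos (t * y) + sin (t * x) * sin (t * y) \<partial>M)"
      using ints by simp
    also have "\<dots> \<le> (\<integral>y. 1 - t\<^sup>2 / 2 * (x\<^sup>2 - 2 * x * y + y\<^sup>2) +
        \<bar>t\<bar> ^ 3 / 6 * (2 * \<bar>x\<bar> ^ 3 + 2 * \<bar>y\<bar> ^ 3 - 2 * x * \<bar>x\<bar> * y - 2 * x * (y * \<bar>y\<bar>)) \<partial>M)"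
    proof (rule integral_mono)
      fix y
      have "cos (t * x) * cos (t * y) + sin (t * x) * sin (t * y) = cos (t * (x - y))"
        by (simp add: right_diff_distrib cos_diff)
      also have "\<dots> \<le> 1 - (t * (x - y))\<^sup>2 / 2 + \<bar>t * (x - y)\<bar> ^ 3 / 6"
        by (rule cos_le_cubic)
      also have "\<dots> = 1 - t\<^sup>2 / 2 * (x\<^sup>2 - 2 * x * y + y\<^sup>2) + \<bar>t\<bar> ^ 3 / 6 * \<bar>x - y\<bar> ^ 3"
        by (simp add: abs_mult power_mult_distrib power2_diff)
      also have "\<dots> \<le> 1 - t\<^sup>2 / 2 * (x\<^sup>2 - 2 * x * y + y\<^sup>2) +
          \<bar>t\<bar> ^ 3 / 6 * (2 * \<bar>x\<bar> ^ 3 + 2 * \<bar>y\<bar> ^ 3 - 2 * x * \<bar>x\<bar> * y - 2 * x * (y * \<bar>y\<bar>))"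
        by (intro add_left_mono mult_left_mono abs_diff_cubed_le) simp
      finally show "cos (t * x) * cos (t * y) + sin (t * x) * sin (t * y) \<le> \<dots>" .
    qed (use ints in simp_all)
    \<comment> \<open>Mean zero in y removes the terms linear in y; the term x times
      \<open>?m\<close> stays until the outer integration removes it by mean zero in x.\<close>
    also have "\<dots> = 1 - t\<^sup>2 / 2 * (x\<^sup>2 + v) + \<bar>t\<bar> ^ 3 / 6 * (2 * \<bar>x\<bar> ^ 3 + 2 * b3 - 2 * x * ?m)"
      using ints prob_space mean_zero by simp
    finally show ?thesis .
  qed
  have "(cmod (char M t))\<^sup>2 = ?C * ?C + ?S * ?S"
    unfolding char by (simp add: cmod_def power2_eq_square)
  also have "\<dots> = (\<integral>x. cos (t * x) * ?C + sin (t * x) * ?S \<partial>M)"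
    using ints by simp
  also have "\<dots> \<le> (\<integral>x. 1 - t\<^sup>2 / 2 * (x\<^sup>2 + v) + \<bar>t\<bar> ^ 3 / 6 * (2 * \<bar>x\<bar> ^ 3 + 2 * b3 - 2 * x * ?m) \<partial>M)"
    using ints by (intro integral_mono inner) simp_all
  also have "\<dots> = 1 - t\<^sup>2 / 2 * (v + v) + \<bar>t\<bar> ^ 3 / 6 * (2 * b3 + 2 * b3)"
    using ints prob_space mean_zero by simp
  finally show ?thesis
    by (simp add: algebra_simps)
qed

lemma cmod_char_le_exp: "cmod (char M t) \<le> exp (- v * t\<^sup>2 / 2 + b3 * \<bar>t\<bar> ^ 3 / 3)"
proof (rule power2_le_imp_le)
  have "(cmod (char M t))\<^sup>2 \<le> 1 + (- v * t\<^sup>2 + 2 / 3 * b3 * \<bar>t\<bar> ^ 3)"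
    using cmod_char_squared_le[of t] by simp
  also have "\<dots> \<le> exp (- v * t\<^sup>2 + 2 / 3 * b3 * \<bar>t\<bar> ^ 3)"
    by (rule exp_ge_add_one_self)
  also have "\<dots> = (exp (- v * t\<^sup>2 / 2 + b3 * \<bar>t\<bar> ^ 3 / 3))\<^sup>2"
    by (simp add: exp_double[symmetric])
  finally show "(cmod (char M t))\<^sup>2 \<le> (exp (- v * t\<^sup>2 / 2 + b3 * \<bar>t\<bar> ^ 3 / 3))\<^sup>2" .
qed simp

text \<open>Both functions are compared with 1 - w, where w = v t^2 / 2. Smallness of b3 |t|^3
  forces sqrt v |t| <= 1 by Lyapunov's inequality, so the Gaussian error, quartic in sqrt v |t|, is
  absorbed by the cubic term.\<close>

lemma char_minus_gaussian_le:
  assumes "b3 * \<bar>t\<bar> ^ 3 \<le> 1"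
  shows "cmod (char M t - exp (- v * t\<^sup>2 / 2)) \<le>
    2 * b3 * \<bar>t\<bar> ^ 3 * exp (- v * t\<^sup>2 / 2 + b3 * \<bar>t\<bar> ^ 3 / 3)"
proof -
  define w where "w = v * t\<^sup>2 / 2"
  define s where "s = sqrt v * \<bar>t\<bar>"
  have w: "w = s\<^sup>2 / 2" "0 \<le> s"
    by (simp_all add: w_def s_def power_mult_distrib)
  have s3: "s ^ 3 \<le> b3 * \<bar>t\<bar> ^ 3"
    unfolding s_def power_mult_distrib by (intro mult_right_mono sqrt_v_cubed_le) simp
  have "s \<le> 1"
    using s3 assms w(2) by (metis order_trans power_le_one_iff zero_neq_numeral)
  have w_le: "w \<le> 1 / 2" "0 \<le> w" "w\<^sup>2 \<le> s ^ 3 / 4"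
  proof -
    show "w \<le> 1 / 2" "0 \<le> w"
      unfolding w(1) using w(2) \<open>s \<le> 1\<close> by (simp_all add: power_le_one)
    have "s ^ 4 \<le> s ^ 3"
      using w(2) \<open>s \<le> 1\<close> by (intro power_decreasing) auto
    then show "w\<^sup>2 \<le> s ^ 3 / 4"
      unfolding w(1) by (simp add: power_divide)
  qed
  have "cmod (char M t - (1 - w)) \<le> b3 * \<bar>t\<bar> ^ 3 / 6"
  proof -
    have "cmod (char M t - (\<Sum>k\<le>2. ((\<i> * t) ^ k / fact k) * expectation (\<lambda>x. x ^ k))) \<le>
        (\<bar>t\<bar>\<^sup>2 / fact (Suc 2)) * expectation (\<lambda>x. min (2 * \<bar>x\<bar>\<^sup>2 * Suc 2) (\<bar>t\<bar> * \<bar>x\<bar> ^ Suc 2))"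
      by (rule char_approx2) (auto intro: integrable_power_le3)
    also have "(\<Sum>k\<le>2. ((\<i> * t) ^ k / fact k) * expectation (\<lambda>x. x ^ k)) = of_real (1 - w)"
      using prob_space mean_zero by (simp add: numeral_eq_Suc w_def power_mult_distrib)
    \<comment> \<open>Only the second branch of the \<open>min\<close> is kept; with 3! in the
      denominator it yields the constant 1/6.\<close>
    also have "(\<bar>t\<bar>\<^sup>2 / fact (Suc 2)) * expectation (\<lambda>x. min (2 * \<bar>x\<bar>\<^sup>2 * Suc 2) (\<bar>t\<bar> * \<bar>x\<bar> ^ Suc 2)) \<le>
        (\<bar>t\<bar>\<^sup>2 / fact (Suc 2)) * expectation (\<lambda>x. \<bar>t\<bar> * \<bar>x\<bar> ^ 3)"
    proof (intro mult_left_mono integral_mono)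
      have "integrable M (\<lambda>x. 2 * \<bar>x\<bar>\<^sup>2 * Suc 2)" "integrable M (\<lambda>x. \<bar>t\<bar> * \<bar>x\<bar> ^ Suc 2)"
        using integrable_square integrable_abs3 by (simp_all add: numeral_eq_Suc)
      then show "integrable M (\<lambda>x. min (2 * \<bar>x\<bar>\<^sup>2 * Suc 2) (\<bar>t\<bar> * \<bar>x\<bar> ^ Suc 2))"
        by (rule integrable_min)
    qed (use integrable_abs3 in \<open>auto simp: numeral_eq_Suc\<close>)
    also have "\<dots> = b3 * \<bar>t\<bar> ^ 3 / 6"
      by (simp add: numeral_eq_Suc)
    finally show ?thesis
      by simp
  qed
  moreover have "\<bar>exp (- w) - (1 - w)\<bar> \<le> w\<^sup>2 / 2"
    by (rule abs_exp_minus_linear_le[OF w_le(2)])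
  ultimately have "cmod (char M t - exp (- w)) \<le> b3 * \<bar>t\<bar> ^ 3 / 6 + w\<^sup>2 / 2"
  proof -
    assume char: "cmod (char M t - (1 - w)) \<le> b3 * \<bar>t\<bar> ^ 3 / 6" and exp: "\<bar>exp (- w) - (1 - w)\<bar> \<le> w\<^sup>2 / 2"
    have "cmod (char M t - exp (- w)) =
        cmod ((char M t - (1 - w)) - of_real (exp (- w) - (1 - w)))"
      by simp
    also have "\<dots> \<le> cmod (char M t - (1 - w)) + cmod (of_real (exp (- w) - (1 - w)))"
      by (rule norm_triangle_ineq4)
    also have "\<dots> \<le> b3 * \<bar>t\<bar> ^ 3 / 6 + w\<^sup>2 / 2"
      using char exp by (intro add_mono) (simp_all only: norm_of_real)
    finally show ?thesis .
  qed
  \<comment> \<open>7/24 = 1/6 + 1/8: the Taylor error of the characteristic function plus w^2 / 2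
    <= s^3 / 8.\<close>
  also have "\<dots> \<le> b3 * \<bar>t\<bar> ^ 3 * (7 / 24)"
    using w_le(3) s3 by linarith
  also have "\<dots> \<le> b3 * \<bar>t\<bar> ^ 3 * (2 * exp (- w + b3 * \<bar>t\<bar> ^ 3 / 3))"
  proof (rule mult_left_mono)
    have "1 + - w \<le> exp (- w)"
      by (rule exp_ge_add_one_self)
    also have "\<dots> \<le> exp (- w + b3 * \<bar>t\<bar> ^ 3 / 3)"
      using b3_nonneg by simp
    finally show "7 / 24 \<le> 2 * exp (- w + b3 * \<bar>t\<bar> ^ 3 / 3)"
      using w_le(1) by simp
  qed (use b3_nonneg in simp)
  finally show ?thesis
    by (simp add: w_def)
qed

end

subsection \<open>The Berry--Esseen inequality\<close>

text \<open>Telescoping one factor at a time. Errors are measured relative to \<open>A i\<close>, so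
  each term carries the full product of the \<open>A i\<close> and no decay is lost, even where some
  \<open>A i\<close> exceeds 1.\<close>

lemma norm_prod_diff_weighted:
  fixes z w :: "'i \<Rightarrow> complex" and A c :: "'i \<Rightarrow> real"
  assumes "finite I"
    and "\<And>i. i \<in> I \<Longrightarrow> cmod (z i) \<le> A i" "\<And>i. i \<in> I \<Longrightarrow> cmod (w i) \<le> A i"
    and "\<And>i. i \<in> I \<Longrightarrow> cmod (z i - w i) \<le> c i * A i"
  shows "cmod (prod z I - prod w I) \<le> sum c I * prod A I"
  using assms
proof (induction I)
  case (insert i I)
  have A: "0 \<le> A j" if "j \<in> insert i I" for j
    using insert.prems(1)[OF that] norm_ge_zero[of "z j"] by linarith
  have "cmod (prod w I) \<le> prod A I"
    unfolding prod_norm[symmetric] using insert.prems(2) by (intro prod_mono) auto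
  then have w: "cmod ((z i - w i) * prod w I) \<le> (c i * A i) * prod A I"
    unfolding norm_mult using insert.prems(3)[of i]
    by (intro mult_mono) (auto intro: order_trans[OF norm_ge_zero])
  have "cmod (prod z I - prod w I) \<le> sum c I * prod A I"
    using insert by simp
  then have z: "cmod (z i * (prod z I - prod w I)) \<le> A i * (sum c I * prod A I)"
    unfolding norm_mult using insert.prems(1)[of i] A[of i] by (intro mult_mono) auto
  have "prod z (insert i I) - prod w (insert i I) = z i * (prod z I - prod w I) + (z i - w i) * prod w I"
    using insert.hyps by (simp add: algebra_simps)
  also have "cmod \<dots> \<le> A i * (sum c I * prod A I) + (c i * A i) * prod A I"
    by (rule order_trans[OF norm_triangle_ineq add_mono[OF z w]])
  also have "\<dots> = sum c (insert i I) * prod A (insert i I)"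
    using insert.hyps by (simp add: algebra_simps)
  finally show ?case .
qed simp

lemma char_prod_minus_gaussian_le:
  fixes \<mu> :: "'i \<Rightarrow> real measure"
  assumes "finite I" and \<mu>: "\<And>i. i \<in> I \<Longrightarrow> third_moment (\<mu> i)"
  defines "V \<equiv> \<Sum>i\<in>I. \<integral>x. x\<^sup>2 \<partial>\<mu> i" and "S \<equiv> \<Sum>i\<in>I. \<integral>x. \<bar>x\<bar> ^ 3 \<partial>\<mu> i"
  shows "cmod ((\<Prod>i\<in>I. char (\<mu> i) t) - exp (- V * t\<^sup>2 / 2)) \<le>
    2 * (S * \<bar>t\<bar> ^ 3) * exp (- V * t\<^sup>2 / 2 + S * \<bar>t\<bar> ^ 3 / 3)"
proof -
  define v where "v i = (\<integral>x. x\<^sup>2 \<partial>\<mu> i)" for i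
  define \<beta> where "\<beta> i = (\<integral>x. \<bar>x\<bar> ^ 3 \<partial>\<mu> i)" for i
  define A where "A i = exp (- v i * t\<^sup>2 / 2 + \<beta> i * \<bar>t\<bar> ^ 3 / 3)" for i
  let ?E = "exp (- V * t\<^sup>2 / 2 + S * \<bar>t\<bar> ^ 3 / 3)"
  have nonneg: "0 \<le> v i" "0 \<le> \<beta> i" for i
    by (simp_all add: v_def \<beta>_def)
  then have S: "0 \<le> S"
    unfolding S_def by (auto intro!: sum_nonneg)
  have VS: "V = sum v I" "S = sum \<beta> I"
    by (simp_all add: V_def S_def v_def \<beta>_def)
  have prod_A: "prod A I = ?E"
    unfolding A_def VS using assms(1)
    by (simp add: exp_sum[symmetric] sum.distrib sum_distrib_right sum_divide_distrib sum_negf sum_subtractf)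
  have char_le: "cmod (char (\<mu> i) t) \<le> A i" if "i \<in> I" for i
    using third_moment.cmod_char_le_exp[OF \<mu>[OF that]] by (simp add: A_def v_def \<beta>_def)
  have gauss: "exp (- V * t\<^sup>2 / 2) = (\<Prod>i\<in>I. exp (- v i * t\<^sup>2 / 2))"
    unfolding VS using assms(1) by (simp add: exp_sum[symmetric] sum_distrib_right sum_divide_distrib sum_negf)
  show ?thesis
  \<comment> \<open>Below the threshold every summand has its own Gaussian estimate, since each
    \<beta> i is at most \<open>S\<close>. Above it the factor 2 of the claim is the number of terms
    in the triangle inequality.\<close>
  proof (cases "S * \<bar>t\<bar> ^ 3 \<le> 1")
    case True
    have "cmod ((\<Prod>i\<in>I. char (\<mu> i) t) - (\<Prod>i\<in>I. complex_of_real (exp (- v i * t\<^sup>2 / 2)))) \<le>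
        (\<Sum>i\<in>I. 2 * \<beta> i * \<bar>t\<bar> ^ 3) * prod A I"
    proof (rule norm_prod_diff_weighted[OF assms(1) char_le])
      fix i
      assume i: "i \<in> I"
      have "\<beta> i \<le> S"
        unfolding VS using i nonneg assms(1) by (intro member_le_sum) auto
      then have "\<beta> i * \<bar>t\<bar> ^ 3 \<le> S * \<bar>t\<bar> ^ 3"
        by (rule mult_right_mono) simp
      then show "cmod (char (\<mu> i) t - complex_of_real (exp (- v i * t\<^sup>2 / 2))) \<le> 2 * \<beta> i * \<bar>t\<bar> ^ 3 * A i"
        using third_moment.char_minus_gaussian_le[OF \<mu>[OF i], of t] True
        by (simp add: A_def v_def \<beta>_def)
      show "cmod (complex_of_real (exp (- v i * t\<^sup>2 / 2))) \<le> A i"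
        unfolding A_def norm_of_real using nonneg by simp
    qed
    also have "(\<Sum>i\<in>I. 2 * \<beta> i * \<bar>t\<bar> ^ 3) = 2 * (S * \<bar>t\<bar> ^ 3)"
      by (simp add: VS sum_distrib_left sum_distrib_right mult.assoc)
    finally show ?thesis
      by (simp only: gauss prod_A of_real_prod)
  next
    case False
    have "cmod ((\<Prod>i\<in>I. char (\<mu> i) t) - exp (- V * t\<^sup>2 / 2)) \<le>
        cmod (\<Prod>i\<in>I. char (\<mu> i) t) + cmod (complex_of_real (exp (- V * t\<^sup>2 / 2)))"
      by (rule norm_triangle_ineq4)
    also have "\<dots> \<le> ?E + ?E"
    proof (rule add_mono)
      show "cmod (\<Prod>i\<in>I. char (\<mu> i) t) \<le> ?E"
        unfolding prod_norm[symmetric] prod_A[symmetric] using char_le by (intro prod_mono) auto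
      show "cmod (complex_of_real (exp (- V * t\<^sup>2 / 2))) \<le> ?E"
        unfolding norm_of_real using S by simp
    qed
    also have "\<dots> = 2 * 1 * ?E"
      by simp
    also have "\<dots> \<le> 2 * (S * \<bar>t\<bar> ^ 3) * ?E"
      using False by (intro mult_right_mono mult_left_mono) auto
    finally show ?thesis .
  qed
qed

section \<open>The normal law: second moment, distribution function, density bound\<close>

lemma has_bochner_integral_square_gaussian:
  assumes "c > 0"
  shows "has_bochner_integral lborel (\<lambda>t. t\<^sup>2 * exp (- c * t\<^sup>2 / 2)) (sqrt (2 * pi) / c powr (3 / 2))"
proof -
  define \<sigma> where "\<sigma> = 1 / sqrt c"
  have \<sigma>: "\<sigma> > 0" "\<sigma>\<^sup>2 = 1 / c"
    using assms by (simp_all add: \<sigma>_def power_divide)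
  have "has_bochner_integral lborel (\<lambda>t. normal_density 0 \<sigma> t * t\<^sup>2) (1 / c)"
    using normal_moment_even[OF \<sigma>(1), of 0 1] by (simp add: \<sigma>(2))
  from has_bochner_integral_mult_right[OF this, of "sqrt (2 * pi / c)"]
  have "has_bochner_integral lborel (\<lambda>t. sqrt (2 * pi / c) * (normal_density 0 \<sigma> t * t\<^sup>2)) (sqrt (2 * pi / c) * (1 / c))"
    by simp
  also have "(\<lambda>t. sqrt (2 * pi / c) * (normal_density 0 \<sigma> t * t\<^sup>2)) = (\<lambda>t. t\<^sup>2 * exp (- c * t\<^sup>2 / 2))"
    using assms by (simp add: normal_density_def \<sigma>(2) mult.commute)
  also have "sqrt (2 * pi / c) * (1 / c) = sqrt (2 * pi) / c powr (3 / 2)"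
  proof -
    have "c powr (3 / 2) = c powr (1 + 1 / 2)"
      by simp
    also have "\<dots> = c * sqrt c"
      using assms by (simp only: powr_add) (simp add: powr_half_sqrt)
    finally show ?thesis
      by (simp add: real_sqrt_divide)
  qed
  finally show ?thesis .
qed

text \<open>Points are null for the normal law, so the right-continuous \<open>cdf\<close> agrees
  with the left-continuous convention used for the sum.\<close>

lemma std_normal_cdf_eq_measure_lessThan: "std_normal_cdf x = measure std_normal_distribution {..<x}"
proof -
  have "emeasure std_normal_distribution {..x} = emeasure std_normal_distribution {..<x}"
    using AE_lborel_singleton[of x]
    by (subst (1 2) emeasure_density)
      (auto intro!: nn_integral_cong_AE elim!: eventually_mono split: split_indicator)
  then show ?thesis
    by (simp add: std_normal_cdf_def cdf_def measure_def)
qed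

text \<open>The density is largest at 0, with value 1 / sqrt (2 pi); this becomes the slope
  \<open>q\<close> of the smoothing inequality.\<close>

lemma measure_std_normal_Ico_le:
  assumes "x \<le> y"
  shows "measure std_normal_distribution {x..<y} \<le> 1 / sqrt (2 * pi) * (y - x)"
proof -
  interpret real_distribution std_normal_distribution
    by (rule real_dist_normal_dist)
  have "emeasure std_normal_distribution {x..<y} =
      (\<integral>\<^sup>+u. ennreal (std_normal_density u) * indicator {x..<y} u \<partial>lborel)"
    by (subst emeasure_density) auto
  also have "\<dots> \<le> (\<integral>\<^sup>+u. ennreal (1 / sqrt (2 * pi)) * indicator {x..<y} u \<partial>lborel)"
    by (intro nn_integral_mono mult_right_mono)
      (auto simp: std_normal_density_def divide_right_mono intro!: ennreal_leI)
  also have "\<dots> = ennreal (1 / sqrt (2 * pi) * (y - x))"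
    using assms by (simp add: nn_integral_cmult ennreal_mult[symmetric])
  finally show ?thesis
    using assms by (simp add: emeasure_eq_measure)
qed

lemma berry_esseen_by_char_bound:
  fixes \<mu> :: "real measure"
  assumes \<mu>: "real_distribution \<mu>" "integrable \<mu> (\<lambda>x. x)"
    and "L > 0" "b > 1" "0 < d" "d < 3 / 2"
    and char: "\<And>t. cmod (char \<mu> t - exp (- t\<^sup>2 / 2)) \<le> 2 * (L * \<bar>t\<bar> ^ 3) * exp (- t\<^sup>2 / 2 + L * \<bar>t\<bar> ^ 3 / 3)"
  shows "\<bar>measure \<mu> {..<x} - std_normal_cdf x\<bar> \<le>
    2 / sqrt (2 * pi) * (b / (1 - 2 * d / 3) powr (3 / 2) + 2 * b * (b + 1) / (pi * d * (b - 1))) * L"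
proof -
  interpret \<mu>: real_distribution \<mu>
    by fact
  interpret \<nu>: real_distribution std_normal_distribution
    by (rule real_dist_normal_dist)
  have id: "integrable std_normal_distribution (\<lambda>x. x)"
    using integrable_std_normal_distribution_moment[of 1] by simp
  define D where "D u = measure \<mu> {..<u} - measure std_normal_distribution {..<u}" for u
  \<comment> \<open>The band [- 2 a, 2 a] becomes |t| <= d / L, where L |t|^3 <= d t^2.\<close>
  define a where "a = d / (2 * L)"
  define c where "c = 1 - 2 * d / 3"
  \<comment> \<open>The 1 / |t| in the transform of D lowers |t|^3 to t^2; kept on the whole line,
    the bound integrates to a Gaussian second moment.\<close>
  define W where "W t = 2 * L * (t\<^sup>2 * exp (- c * t\<^sup>2 / 2))" for t
  have a: "a > 0" and c: "c > 0"
    using assms by (auto simp: a_def c_def)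
  note fourier = fourier_distribution_difference[OF \<mu> real_dist_normal_dist id, folded D_def]
  have W: "has_bochner_integral lborel W (2 * L * (sqrt (2 * pi) / c powr (3 / 2)))"
    unfolding W_def by (intro has_bochner_integral_mult_right has_bochner_integral_square_gaussian c)
  have D_fourier: "cmod (\<integral>u. D u *\<^sub>R iexp (t * u) \<partial>lborel) \<le> W t" if t: "t \<noteq> 0" "\<bar>t\<bar> \<le> 2 * a" for t
  proof -
    have "L * \<bar>t\<bar> ^ 3 = L * \<bar>t\<bar> * t\<^sup>2"
      by (simp add: power3_eq_cube power2_eq_square)
    also have "\<dots> \<le> d * t\<^sup>2"
      using t(2) \<open>L > 0\<close> by (intro mult_right_mono) (auto simp: a_def field_simps)
    finally have exponent: "- t\<^sup>2 / 2 + L * \<bar>t\<bar> ^ 3 / 3 \<le> - c * t\<^sup>2 / 2"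
      by (simp add: c_def field_simps)
    have "cmod (\<integral>u. D u *\<^sub>R iexp (t * u) \<partial>lborel) = cmod (char \<mu> t - exp (- t\<^sup>2 / 2)) / \<bar>t\<bar>"
      unfolding fourier(2)[OF t(1)]
      by (simp add: char_std_normal_distribution norm_divide norm_mult norm_minus_commute)
    also have "\<dots> \<le> 2 * (L * \<bar>t\<bar> ^ 3) * exp (- c * t\<^sup>2 / 2) / \<bar>t\<bar>"
      using exponent \<open>L > 0\<close>
      by (intro divide_right_mono order_trans[OF char] mult_left_mono) auto
    also have "\<dots> = W t"
      using t(1) by (simp add: W_def power3_eq_cube power2_eq_square)
    finally show ?thesis .
  qed
  have "\<bar>D x\<bar> \<le> b * (integral\<^sup>L lborel W / (2 * pi)) +
      1 / sqrt (2 * pi) * (2 * b * (b + 1) / (pi * a * (b - 1)))"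
  proof (rule smoothing_inequality[where D = D and c = 1, OF a \<open>b > 1\<close>])
    show "D \<in> borel_measurable borel"
      using fourier(1) by auto
    show "\<bar>D x\<bar> \<le> 1" for x
      unfolding D_def using \<mu>.prob_le_1[of "{..<x}"] \<nu>.prob_le_1[of "{..<x}"]
      by (simp add: abs_le_iff add_increasing2 diff_le_eq)
    show "\<bar>\<integral>y. D (x - y) * fejer a y \<partial>lborel\<bar> \<le> integral\<^sup>L lborel W / (2 * pi)" for x
    proof (rule fejer_convolution_bound[OF a fourier(1) _ _ D_fourier])
      show "integrable lborel W"
        using W by (simp add: has_bochner_integral_iff)
      show "0 \<le> W t" for t
        using \<open>L > 0\<close> by (simp add: W_def)
    qed
    show "D x - D y \<le> 1 / sqrt (2 * pi) * (y - x)" if "x \<le> y" for x y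
    proof -
      \<comment> \<open>The distribution function of \<mu> is monotone, so D can fall only as fast
        as the normal one rises.\<close>
      have "measure \<mu> {..<x} \<le> measure \<mu> {..<y}"
        using that by (intro \<mu>.finite_measure_mono) auto
      moreover have "{..<y} - {..<x} = {x..<y}"
        by auto
      then have "measure std_normal_distribution {..<y} - measure std_normal_distribution {..<x} =
          measure std_normal_distribution {x..<y}"
        using that \<nu>.finite_measure_Diff[of "{..<y}" "{..<x}"] by auto
      ultimately show ?thesis
        using measure_std_normal_Ico_le[OF that] unfolding D_def by linarith
    qed
  qed
  also have "\<dots> = 2 / sqrt (2 * pi) * (b / c powr (3 / 2) + 2 * b * (b + 1) / (pi * d * (b - 1))) * L"
  proof -
    have inverse_sqrt: "sqrt (2 * pi) / (2 * pi) = 1 / sqrt (2 * pi)"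
      by (simp add: real_div_sqrt field_simps)
    have "b * (integral\<^sup>L lborel W / (2 * pi)) = 2 * (sqrt (2 * pi) / (2 * pi)) * (b / c powr (3 / 2)) * L"
      using W by (simp add: has_bochner_integral_iff mult_ac)
    also have "\<dots> = 2 / sqrt (2 * pi) * (b / c powr (3 / 2)) * L"
      unfolding inverse_sqrt by simp
    finally have "b * (integral\<^sup>L lborel W / (2 * pi)) = 2 / sqrt (2 * pi) * (b / c powr (3 / 2)) * L" .
    moreover have "2 * b * (b + 1) / (pi * a * (b - 1)) = 2 * (2 * b * (b + 1) / (pi * d * (b - 1))) * L"
      by (simp add: a_def)
    ultimately show ?thesis
      by (simp add: algebra_simps)
  qed
  finally show ?thesis
    by (simp add: D_def c_def std_normal_cdf_eq_measure_lessThan)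
qed

theorem mainTheorem7:
  fixes M :: "'a measure" and X :: "nat \<Rightarrow> 'a \<Rightarrow> real" and n :: nat
  assumes "prob_space M"
    and "prob_space.indep_vars M (\<lambda>_. borel) X {1..n}"
    and "\<And>k. k \<in> {1..n} \<Longrightarrow> integrable M (\<lambda>\<omega>. \<bar>X k \<omega>\<bar> ^ 3)"
    and "\<And>k. k \<in> {1..n} \<Longrightarrow> (\<integral>\<omega>. X k \<omega> \<partial>M) = 0"
    and "sum_variance M X n > 0"
  shows "normal_distance M X n \<le> berry_esseen_const * lyapunov_fraction3 M X n"
proof -
  interpret prob_space M
    by fact
  define B where "B = norming M X n"
  define S where "S = (\<Sum>k=1..n. \<integral>\<omega>. \<bar>X k \<omega>\<bar> ^ 3 \<partial>M)"
  define L where "L = lyapunov_fraction3 M X n"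
  define \<mu> where "\<mu> = distr M borel (\<lambda>\<omega>. (\<Sum>k=1..n. X k \<omega>) / B)"
  have meas [measurable]: "X k \<in> borel_measurable M" if "k \<in> {1..n}" for k
    using assms(2) that unfolding indep_vars_def by auto
  have B: "B > 0" "B\<^sup>2 = sum_variance M X n"
    using assms(5) by (auto simp: B_def norming_def)
  have LS: "L = S / B ^ 3"
    by (simp add: L_def S_def B_def lyapunov_fraction3_def)
  have X: "third_moment (distr M borel (X k))" if k: "k \<in> {1..n}" for k
  proof (intro third_moment.intro third_moment_axioms.intro)
    show "real_distribution (distr M borel (X k))"
      using k by (intro real_distribution_distr) simp
  qed (use k assms(3,4) in \<open>simp_all add: integrable_distr_eq integral_distr\<close>)
  have moments: "(\<integral>x. x\<^sup>2 \<partial>distr M borel (X k)) = (\<integral>\<omega>. (X k \<omega>)\<^sup>2 \<partial>M)"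
      "(\<integral>x. \<bar>x\<bar> ^ 3 \<partial>distr M borel (X k)) = (\<integral>\<omega>. \<bar>X k \<omega>\<bar> ^ 3 \<partial>M)" if "k \<in> {1..n}" for k
    using that by (simp_all add: integral_distr)
  \<comment> \<open>Positivity allows the bandwidth d / L and the later division by L; it comes from
    a summand of positive variance through Lyapunov's inequality.\<close>
  have L: "L > 0"
  proof -
    obtain k where k: "k \<in> {1..n}" "(\<integral>\<omega>. (X k \<omega>)\<^sup>2 \<partial>M) > 0"
      using assms(5) sum_nonpos[of "{1..n}" "\<lambda>k. \<integral>\<omega>. (X k \<omega>)\<^sup>2 \<partial>M"]
      unfolding sum_variance_def by (meson not_le)
    have "0 < sqrt (\<integral>\<omega>. (X k \<omega>)\<^sup>2 \<partial>M) ^ 3"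
      using k(2) by simp
    also have "\<dots> \<le> (\<integral>\<omega>. \<bar>X k \<omega>\<bar> ^ 3 \<partial>M)"
      using third_moment.sqrt_v_cubed_le[OF X[OF k(1)]] by (simp add: moments[OF k(1)])
    also have "\<dots> \<le> S"
      unfolding S_def using k(1) by (intro member_le_sum) auto
    finally show ?thesis
      using B by (simp add: LS)
  qed
  have \<mu>: "real_distribution \<mu>"
    unfolding \<mu>_def by (intro real_distribution_distr) simp
  have "integrable M (X k)" if "k \<in> {1..n}" for k
    using third_moment.integrable_id[OF X[OF that]] that by (simp add: integrable_distr_eq)
  then have "integrable M (\<lambda>\<omega>. (\<Sum>k=1..n. X k \<omega>) / B)"
    by (intro integrable_divide Bochner_Integration.integrable_sum)
  then have \<mu>_id: "integrable \<mu> (\<lambda>x. x)"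
    unfolding \<mu>_def by (subst integrable_distr_eq) simp_all
  have char: "cmod (char \<mu> t - exp (- t\<^sup>2 / 2)) \<le>
      2 * (L * \<bar>t\<bar> ^ 3) * exp (- t\<^sup>2 / 2 + L * \<bar>t\<bar> ^ 3 / 3)" for t
  proof -
    \<comment> \<open>Division by B moves into the argument t / B, so the product estimate applies
      to the unscaled summands and the scaling cancels afterwards.\<close>
    have "char \<mu> t = char (distr M borel (\<lambda>\<omega>. \<Sum>k=1..n. X k \<omega>)) (t / B)"
      unfolding \<mu>_def char_def by (simp add: integral_distr)
    also have "\<dots> = (\<Prod>k=1..n. char (distr M borel (X k)) (t / B))"
      by (rule char_distr_sum[OF assms(2)])
    finally have char_\<mu>: "char \<mu> t = \<dots>" .
    have V: "(\<Sum>k=1..n. \<integral>x. x\<^sup>2 \<partial>distr M borel (X k)) = B\<^sup>2"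
      unfolding B(2) sum_variance_def by (intro sum.cong refl moments(1))
    have S: "(\<Sum>k=1..n. \<integral>x. \<bar>x\<bar> ^ 3 \<partial>distr M borel (X k)) = S"
      unfolding S_def by (intro sum.cong refl moments(2))
    have scale: "- B\<^sup>2 * (t / B)\<^sup>2 / 2 = - t\<^sup>2 / 2" "S * \<bar>t / B\<bar> ^ 3 = L * \<bar>t\<bar> ^ 3"
      using B(1) by (simp_all add: LS power_divide abs_divide)
    show ?thesis
      using char_prod_minus_gaussian_le[where \<mu> = "\<lambda>k. distr M borel (X k)" and t = "t / B",
          OF finite_atLeastAtMost[of 1 n] X]
      unfolding V S char_\<mu> scale by simp
  qed
  have measure_\<mu>: "measure M {\<omega> \<in> space M. partial_sum X n \<omega> < x * norming M X n} = measure \<mu> {..<x}" for x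
  proof -
    have "measure \<mu> {..<x} = measure M ((\<lambda>\<omega>. (\<Sum>k=1..n. X k \<omega>) / B) -` {..<x} \<inter> space M)"
      unfolding \<mu>_def by (intro measure_distr) auto
    also have "(\<lambda>\<omega>. (\<Sum>k=1..n. X k \<omega>) / B) -` {..<x} \<inter> space M =
        {\<omega> \<in> space M. partial_sum X n \<omega> < x * norming M X n}"
      using B(1) by (auto simp: partial_sum_def pos_divide_less_eq B_def[symmetric])
    finally show ?thesis ..
  qed
  let ?K = "{b / (1 - 2 * d / 3) powr (3 / 2) + 2 * b * (b + 1) / (pi * d * (b - 1)) | b d :: real.
      1 < b \<and> 0 < d \<and> d < 3 / 2}"
  have pos: "0 < 2 / sqrt (2 * pi) * L"
    using L by simp
  \<comment> \<open>After division by a positive factor every admissible pair (b, d) gives an upper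
    bound, so the infimum is reached as a bound whether or not it is attained.\<close>
  have "normal_distance M X n / (2 / sqrt (2 * pi) * L) \<le> Inf ?K"
  proof (rule cInf_greatest)
    have "\<exists>(b::real) (d::real). 1 < b \<and> 0 < d \<and> d < 3 / 2"
      by (intro exI[of _ "2::real"] exI[of _ "1::real"]) simp
    then show "?K \<noteq> {}"
      by blast
    fix K
    assume "K \<in> ?K"
    then obtain b d :: real where bd: "1 < b" "0 < d" "d < 3 / 2"
      and K: "K = b / (1 - 2 * d / 3) powr (3 / 2) + 2 * b * (b + 1) / (pi * d * (b - 1))"
      by blast
    have "normal_distance M X n \<le> 2 / sqrt (2 * pi) * K * L"
      unfolding normal_distance_def measure_\<mu> K
      by (intro cSUP_least berry_esseen_by_char_bound[OF \<mu> \<mu>_id L bd char]) simp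
    then show "normal_distance M X n / (2 / sqrt (2 * pi) * L) \<le> K"
      unfolding pos_divide_le_eq[OF pos] by (simp only: mult_ac)
  qed
  then have "normal_distance M X n \<le> Inf ?K * (2 / sqrt (2 * pi) * L)"
    by (simp only: pos_divide_le_eq[OF pos])
  then show ?thesis
    unfolding berry_esseen_const_def L_def by (simp only: mult_ac)
qed

end
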